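(* Let $p_1<p_2<\cdots$ be natural numbers $\ge 2$ such that the sequence of compact metric spaces $(\mathbb{Z}/p_n\mathbb{Z},\tilde d_{p_n})_{n\ge 1}$ converges in the Gromov-Hausdorff sense to $(\mathbb{Z}/\infty\mathbb{Z},\tilde d_\infty)$. Then the absolute value function $\|\cdot\|_\infty:\mathbb{Z}/\infty\mathbb{Z}\to\mathbb{R}$, $\|x\|_\infty:=\tilde d_\infty([0]_\infty,x)$, is Archimedean; that is, the strong triangle inequality $\|x+_\infty y\|_\infty\le\max\{\|x\|_\infty,\|y\|_\infty\}$ is violated: there are $x,y,z\in\mathbb{Z}/\infty\mathbb{Z}$ with $z=x+_\infty y$ (i.e. $(x,y,z)\in\tilde{+}_\infty$) and $\|z\|_\infty>\max\{\|x\|_\infty,\|y\|_\infty\}$.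
   Context: For $p\in\mathbb{N}$, $p\ge 2$, each class $[n]_p\in\mathbb{Z}/p\mathbb{Z}$ has a unique representative $n_0\in[n]_p$ with $0\le n_0\le p-1$. Define $d_p([n]_p,[m]_p):=|n_0-m_0|$ and the normalized metric $\tilde d_p:=\frac{1}{p-1}d_p$. The symbol $(\mathbb{Z}/\infty\mathbb{Z},\tilde d_\infty)$ denotes the Gromov-Hausdorff limit (a compact metric space) of the given convergent sequence. The convergence is realized by fixing isometric embeddings of all the spaces $\mathbb{Z}/p_n\mathbb{Z}$ and of $\mathbb{Z}/\infty\mathbb{Z}$ into a common compact metric space $Y$ such that the images of $\mathbb{Z}/p_n\mathbb{Z}$ converge to the image of $\mathbb{Z}/\infty\mathbb{Z}$ in the Hausdorff distance, and such that the classes $[0]_{p_n}$ converge in $Y$ to a point $[0]_\infty\in\mathbb{Z}/\infty\mathbb{Z}$. The limit addition $+_\infty$ is given by its graph $\tilde{+}_\infty\subset(\mathbb{Z}/\infty\mathbb{Z})^3$, the limit as $n\to\infty$ (in $Y^3$) of the graphs $\tilde{+}_{p_n}=\{([k]_{p_n},[m]_{p_n},[k+m]_{p_n})\}\subset(\mathbb{Z}/p_n\mathbb{Z})^3$. *)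

theory Defs
  imports "HOL-Analysis.Analysis" "HOL-Algebra.IntRing" "HOL-Library.Extended_Nonnegative_Real"
begin

section \<open>Hausdorff and Gromov-Hausdorff convergence\<close>

definition isometric_embedding :: "'a metric \<Rightarrow> 'b metric \<Rightarrow> ('a \<Rightarrow> 'b) \<Rightarrow> bool" where
  "isometric_embedding X Y f \<longleftrightarrow> f \<in> mspace X \<rightarrow> mspace Y \<and>
     (\<forall>x\<in>mspace X. \<forall>y\<in>mspace X. mdist Y (f x) (f y) = mdist X x y)"

text \<open>Both distances take values in \<^typ>\<open>ennreal\<close>, so that an infimum over the empty set is \<open>\<infinity>\<close>;
  in particular the distance between an empty and a nonempty set is \<open>\<infinity>\<close>.\<close>

definition hausdorff_distance :: "'a metric \<Rightarrow> 'a set \<Rightarrow> 'a set \<Rightarrow> ennreal" where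
  "hausdorff_distance X A B = Inf {ennreal r |r. 0 \<le> r \<and>
     (\<forall>a\<in>A. \<exists>b\<in>B. mdist X a b \<le> r) \<and> (\<forall>b\<in>B. \<exists>a\<in>A. mdist X a b \<le> r)}"

definition hausdorff_converges :: "'a metric \<Rightarrow> (nat \<Rightarrow> 'a set) \<Rightarrow> 'a set \<Rightarrow> bool" where
  "hausdorff_converges X A B \<longleftrightarrow> (\<lambda>n. hausdorff_distance X (A n) B) \<longlonglongrightarrow> 0"

text \<open>The infimum ranges over all metric spaces \<open>Z\<close> containing isometric copies of \<open>X\<close> and \<open>Y\<close>.
  Taking the points of \<open>Z\<close> from \<^typ>\<open>'a + 'b\<close> is no restriction: \<open>Z\<close> may be replaced
  by the union of the two copies, which has at most as many points as the disjoint union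
  of \<open>X\<close> and \<open>Y\<close>.\<close>

definition gromov_hausdorff_distance :: "'a metric \<Rightarrow> 'b metric \<Rightarrow> ennreal" where
  "gromov_hausdorff_distance X Y =
     Inf {hausdorff_distance Z (f ` mspace X) (g ` mspace Y) |(Z :: ('a + 'b) metric) f g.
            isometric_embedding X Z f \<and> isometric_embedding Y Z g}"

definition gromov_hausdorff_converges :: "(nat \<Rightarrow> 'a metric) \<Rightarrow> 'b metric \<Rightarrow> bool" where
  "gromov_hausdorff_converges X Y \<longleftrightarrow> (\<lambda>n. gromov_hausdorff_distance (X n) Y) \<longlonglongrightarrow> 0"

section \<open>The normalized metric on the integers modulo \<open>p\<close>\<close>

definition least_residue :: "nat \<Rightarrow> int set \<Rightarrow> int" where
  "least_residue p C = (THE n. n \<in> C \<and> 0 \<le> n \<and> n \<le> int p - 1)"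

definition residue_dist :: "nat \<Rightarrow> int set \<Rightarrow> int set \<Rightarrow> real" where
  "residue_dist p C D = real_of_int \<bar>least_residue p C - least_residue p D\<bar>"

definition residue_metric :: "nat \<Rightarrow> int set metric" where
  "residue_metric p =
     metric (carrier (ZFact (int p)), \<lambda>C D. 1 / (real p - 1) * residue_dist p C D)"

definition addition_graph :: "nat \<Rightarrow> (int set \<times> int set \<times> int set) set" where
  "addition_graph p = {(ZMod (int p) k, ZMod (int p) m, ZMod (int p) (k + m)) |k m. True}"

text \<open>\<^const>\<open>metric\<close> is unspecified on arguments that do not form a metric space.\<close>

lemma carrier_ZFact_ZMod: "carrier (ZFact k) = range (ZMod k)"
  by (auto simp: ZFact_defs A_RCOSETS_def RCOSETS_def ZMod_def a_r_coset_def)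

lemma mem_ZMod_iff: "n \<in> ZMod k a \<longleftrightarrow> n mod k = a mod k"
proof -
  have "n \<in> ZMod k a \<longleftrightarrow> (\<exists>x. n = x * k + a)"
    by (auto simp: ZMod_def int_Idl a_r_coset_defs)
  also have "\<dots> \<longleftrightarrow> k dvd n - a"
    by (auto simp: dvd_def algebra_simps)
  finally show ?thesis by (simp add: mod_eq_dvd_iff)
qed

lemma least_residue_ZMod:
  assumes "p \<ge> 2"
  shows "least_residue p (ZMod (int p) a) = a mod int p"
  unfolding least_residue_def mem_ZMod_iff
  using assms by (intro the_equality) auto

lemma Metric_space_residue:
  assumes "p \<ge> 2"
  shows "Metric_space (carrier (ZFact (int p))) (\<lambda>C D. 1 / (real p - 1) * residue_dist p C D)"
proof
  fix C D E
  show "0 \<le> 1 / (real p - 1) * residue_dist p C D"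
    using assms by (simp add: residue_dist_def)
  show "1 / (real p - 1) * residue_dist p C D = 1 / (real p - 1) * residue_dist p D C"
    by (simp add: residue_dist_def abs_minus_commute)
  have "residue_dist p C E \<le> residue_dist p C D + residue_dist p D E"
    by (simp add: residue_dist_def)
  then show "1 / (real p - 1) * residue_dist p C E
      \<le> 1 / (real p - 1) * residue_dist p C D + 1 / (real p - 1) * residue_dist p D E"
    using assms by (simp flip: add_divide_distrib add: divide_right_mono)
  assume "C \<in> carrier (ZFact (int p))" "D \<in> carrier (ZFact (int p))"
  then obtain a b where "C = ZMod (int p) a" "D = ZMod (int p) b"
    by (auto simp: carrier_ZFact_ZMod)
  then show "1 / (real p - 1) * residue_dist p C D = 0 \<longleftrightarrow> C = D"
    using assms by (simp add: residue_dist_def least_residue_ZMod ZMod_eq_mod)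
qed

lemma mspace_residue_metric:
  "p \<ge> 2 \<Longrightarrow> mspace (residue_metric p) = carrier (ZFact (int p))"
  unfolding residue_metric_def by (rule Metric_space.mspace_metric[OF Metric_space_residue])

lemma mdist_residue_metric:
  "p \<ge> 2 \<Longrightarrow> mdist (residue_metric p) C D = 1 / (real p - 1) * residue_dist p C D"
  unfolding residue_metric_def by (subst Metric_space.mdist_metric[OF Metric_space_residue]) simp_all

end

theory Submission
  imports Defs
begin

text \<open>Doubling the middle class \<open>k = (p - 1) div 2\<close> nearly exhausts the diameter: \<open>k\<close> has norm at
  most \<open>1/2\<close>, whereas \<open>2k\<close> has norm at least \<open>1 - 1/(p - 1)\<close>. For large \<open>p\<close> this gap
  survives the replacement of \<open>(k, k, 2k)\<close> by a nearby point of the limit graph.\<close>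

text \<open>The distance is an infimum, so once it drops below \<open>e\<close> some admissible
  radius \<open>r < e\<close> exists; this is what makes the bound strict. Only the direction from
  \<open>A n\<close> to \<open>B\<close> is extracted: approximating points are traced to points of
  the limit.\<close>

lemma hausdorff_converges_eventually_near:
  assumes "hausdorff_converges X A B" "0 < e"
  shows "\<forall>\<^sub>F n in sequentially. \<forall>a\<in>A n. \<exists>b\<in>B. mdist X a b < e"
proof -
  have "\<forall>\<^sub>F n in sequentially. hausdorff_distance X (A n) B < ennreal e"
    using assms unfolding hausdorff_converges_def by (intro order_tendstoD) auto
  then show ?thesis
  proof eventually_elim
    case (elim n)
    then obtain r where r: "0 \<le> r" "ennreal r < ennreal e" "\<forall>a\<in>A n. \<exists>b\<in>B. mdist X a b \<le> r"
      unfolding hausdorff_distance_def Inf_less_iff by blast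
    then have "r < e" by (simp add: ennreal_less_iff)
    with r(3) show ?case by (meson le_less_trans)
  qed
qed

text \<open>Coordinate projections are 1-Lipschitz, since each coordinate distance is dominated by
  the Euclidean combination of both.\<close>

lemma mdist_prod_metric_lessD:
  assumes "mdist (prod_metric X Y) (a, b) (a', b') < e"
  shows "mdist X a a' < e" "mdist Y b b' < e"
proof -
  have "mdist X a a' \<le> mdist (prod_metric X Y) (a, b) (a', b')"
    "mdist Y b b' \<le> mdist (prod_metric X Y) (a, b) (a', b')"
    by (simp_all add: mdist_prod_metric prod_dist_def)
  with assms show "mdist X a a' < e" "mdist Y b b' < e"
    by linarith+
qed

text \<open>Quadrilateral inequality: each sign of the difference takes two triangle inequalities,
  going round through the other pair of points.\<close>

lemma abs_mdist_diff_le: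
  assumes "a \<in> mspace X" "b \<in> mspace X" "a' \<in> mspace X" "b' \<in> mspace X"
  shows "\<bar>mdist X a b - mdist X a' b'\<bar> \<le> mdist X a a' + mdist X b b'"
  using assms mdist_triangle[of a X a' b] mdist_triangle[of a' X b' b]
    mdist_triangle[of a' X a b'] mdist_triangle[of a X b b']
  by (simp add: mdist_commute abs_le_iff)

lemma mdist_residue_metric_zero:
  assumes "q \<ge> 2" "0 \<le> k" "k < int q"
  shows "mdist (residue_metric q) (ZMod (int q) 0) (ZMod (int q) k) = real_of_int k / (real q - 1)"
  using assms by (simp add: mdist_residue_metric residue_dist_def least_residue_ZMod)

theorem proposition5p4:
  fixes p :: "nat \<Rightarrow> nat"
    and X :: "'a metric" and Y :: "'y metric"
    and i :: "nat \<Rightarrow> int set \<Rightarrow> 'y" and j :: "'a \<Rightarrow> 'y"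
    and zero :: 'a and A :: "('a \<times> 'a \<times> 'a) set"
  assumes p_mono: "strict_mono p" and p_ge: "\<And>n. p n \<ge> 2"
    and X_compact: "compact_space (mtopology_of X)"
    and GH: "gromov_hausdorff_converges (\<lambda>n. residue_metric (p n)) X"
    and Y_compact: "compact_space (mtopology_of Y)"
    and i_emb: "\<And>n. isometric_embedding (residue_metric (p n)) Y (i n)"
    and j_emb: "isometric_embedding X Y j"
    and images: "hausdorff_converges Y (\<lambda>n. i n ` mspace (residue_metric (p n))) (j ` mspace X)"
    and zero_in: "zero \<in> mspace X"
    and zero_lim: "limitin (mtopology_of Y) (\<lambda>n. i n (ZMod (int (p n)) 0)) (j zero) sequentially"
    and A_closed: "closedin (mtopology_of (prod_metric X (prod_metric X X))) A"
    and graphs: "hausdorff_converges (prod_metric Y (prod_metric Y Y))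
      (\<lambda>n. map_prod (i n) (map_prod (i n) (i n)) ` addition_graph (p n))
      (map_prod j (map_prod j j) ` A)"
  shows "\<exists>x\<in>mspace X. \<exists>y\<in>mspace X. \<exists>z\<in>mspace X.
    (x, y, z) \<in> A \<and> mdist X zero z > max (mdist X zero x) (mdist X zero y)"
proof -
  have "\<forall>e>0. \<forall>\<^sub>F n in sequentially. i n (ZMod (int (p n)) 0) \<in> mspace Y \<and>
      mdist Y (i n (ZMod (int (p n)) 0)) (j zero) < e"
    using zero_lim
    unfolding mtopology_of_def Metric_space.limitin_metric[OF Metric_space_mspace_mdist]
    by (rule conjunct2)
  \<comment> \<open>An error of 1/20 at zero and another at the second point shift a norm by less
    than 1/10.\<close>
  then have ev_zero: "\<forall>\<^sub>F n in sequentially. i n (ZMod (int (p n)) 0) \<in> mspace Y \<and>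
      mdist Y (i n (ZMod (int (p n)) 0)) (j zero) < 1/20"
    by (rule allE[of _ "1/20"]) simp
  have ev_graph: "\<forall>\<^sub>F n in sequentially.
      \<forall>t\<in>addition_graph (p n). \<exists>s\<in>A. mdist (prod_metric Y (prod_metric Y Y))
        (map_prod (i n) (map_prod (i n) (i n)) t) (map_prod j (map_prod j j) s) < 1/20"
    using hausdorff_converges_eventually_near[OF graphs, of "1/20"]
    by (simp only: ball_simps bex_simps)
  \<comment> \<open>The threshold 11 is where \<open>1 - 1/(q - 1)\<close> reaches 9/10.\<close>
  have ev_large: "\<forall>\<^sub>F n in sequentially. 11 \<le> p n"
    using filterlim_subseq[OF p_mono] by (simp add: filterlim_at_top)
  obtain n where n_zero: "mdist Y (i n (ZMod (int (p n)) 0)) (j zero) < 1/20"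
    and n_large: "11 \<le> p n"
    and n_graph: "\<forall>t\<in>addition_graph (p n). \<exists>s\<in>A. mdist (prod_metric Y (prod_metric Y Y))
        (map_prod (i n) (map_prod (i n) (i n)) t) (map_prod j (map_prod j j) s) < 1/20"
    using eventually_happens'[OF sequentially_bot
      eventually_conj[OF ev_zero eventually_conj[OF ev_large ev_graph]]]
    by (elim exE conjE) (rule that)
  define q where "q = p n"
  have q_large: "11 \<le> q"
    using n_large by (simp add: q_def)
  define k where "k = (int q - 1) div 2"
  define N where "N = (\<lambda>a. mdist (residue_metric q) (ZMod (int q) 0) (ZMod (int q) a))"
  \<comment> \<open>Rounding down keeps \<open>2 * k\<close> below \<open>q\<close>, so doubling
    does not wrap around and \<open>2 * k\<close> is its own least residue; the lower bound is
    attained for even \<open>q\<close>.\<close>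
  have k: "0 \<le> k" "2 * k \<le> int q - 1" "int q - 2 \<le> 2 * k"
    using q_large by (auto simp: k_def)
  have "(ZMod (int q) k, ZMod (int q) k, ZMod (int q) (2 * k)) \<in> addition_graph q"
    unfolding addition_graph_def mult_2 by blast
  from bspec[OF n_graph[folded q_def] this] obtain s where s: "s \<in> A"
    and s_near: "mdist (prod_metric Y (prod_metric Y Y))
      (map_prod (i n) (map_prod (i n) (i n)) (ZMod (int q) k, ZMod (int q) k, ZMod (int q) (2 * k)))
      (map_prod j (map_prod j j) s) < 1/20"
    by (elim bexE) (rule that)
  obtain x y z where s_eq: "s = (x, y, z)"
    by (rule prod_cases3)
  have xyz: "(x, y, z) \<in> A" and near: "mdist (prod_metric Y (prod_metric Y Y))
      (i n (ZMod (int q) k), i n (ZMod (int q) k), i n (ZMod (int q) (2 * k))) (j x, j y, j z) < 1/20"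
    using s s_near by (simp_all only: s_eq map_prod_simp)
  have mem: "x \<in> mspace X" "y \<in> mspace X" "z \<in> mspace X"
    using closedin_subset[OF A_closed] xyz by auto
  \<comment> \<open>Triples are nested pairs, so the last two coordinates need two
    projections.\<close>
  note near_x = mdist_prod_metric_lessD(1)[OF near]
    and near_y = mdist_prod_metric_lessD(1)[OF mdist_prod_metric_lessD(2)[OF near]]
    and near_z = mdist_prod_metric_lessD(2)[OF mdist_prod_metric_lessD(2)[OF near]]
  \<comment> \<open>The isometries \<open>i n\<close> and \<open>j\<close> carry both norms into
    \<open>Y\<close>, where the quadrilateral inequality compares them.\<close>
  have norm_near: "\<bar>N a - mdist X zero w\<bar> < 1/10"
    if "w \<in> mspace X" "mdist Y (i n (ZMod (int q) a)) (j w) < 1/20" for a w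
  proof -
    have res: "ZMod (int q) b \<in> mspace (residue_metric q)" for b
      using p_ge[of n] by (simp add: q_def mspace_residue_metric carrier_ZFact_ZMod)
    have "N a = mdist Y (i n (ZMod (int q) 0)) (i n (ZMod (int q) a))"
      using i_emb[of n] res unfolding isometric_embedding_def N_def q_def by simp
    moreover have "mdist X zero w = mdist Y (j zero) (j w)"
      using j_emb that(1) zero_in unfolding isometric_embedding_def by simp
    moreover have "i n (ZMod (int q) b) \<in> mspace Y" for b
      using i_emb[of n] res unfolding isometric_embedding_def q_def by auto
    moreover have "j zero \<in> mspace Y" "j w \<in> mspace Y"
      using j_emb that(1) zero_in unfolding isometric_embedding_def by auto
    ultimately have "\<bar>N a - mdist X zero w\<bar>
        \<le> mdist Y (i n (ZMod (int q) 0)) (j zero) + mdist Y (i n (ZMod (int q) a)) (j w)"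
      by (simp add: abs_mdist_diff_le)
    with n_zero that(2) show ?thesis unfolding q_def by simp
  qed
  have "N k = real_of_int k / (real q - 1)" "N (2 * k) = real_of_int (2 * k) / (real q - 1)"
    using mdist_residue_metric_zero[of q k] mdist_residue_metric_zero[of q "2 * k"] k q_large
    unfolding N_def by simp_all
  moreover have "2 * real_of_int k \<le> real q - 1" "real q - 2 \<le> 2 * real_of_int k"
    using k(2,3) by linarith+
  moreover have "11 \<le> real q"
    using q_large by simp
  ultimately have "N k \<le> 1/2" "9/10 \<le> N (2 * k)"
    by (simp_all add: pos_divide_le_eq pos_le_divide_eq)
  \<comment> \<open>The norms of \<open>x\<close> and \<open>y\<close> stay below 1/2 + 1/10 = 6/10,
    that of \<open>z\<close> exceeds 9/10 - 1/10 = 8/10.\<close>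
  with norm_near[OF mem(1) near_x] norm_near[OF mem(2) near_y] norm_near[OF mem(3) near_z]
  have "mdist X zero x < mdist X zero z" "mdist X zero y < mdist X zero z"
    by linarith+
  with xyz mem show ?thesis by auto
qed

end
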